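(* Let $\Omega\subset\mathbb{C}^m$ be a Carathéodory hyperbolic domain and let $\Psi\subset\mathscr{S}(\Omega)$ be a set of test functions on $\Omega$ such that, for some $w_0\in\Omega$, $\psi(w_0)=0$ for all $\psi\in\Psi$. Then for all $z_1,z_2\in\Omega$, $$d_\Psi(z_1,z_2)=\sup\{m(\psi(z_1),\psi(z_2)):\psi\in\Psi\}.$$ Moreover, if $\Psi$ is closed under pointwise convergence, then $d_\Psi(z_1,z_2)$ is attained by some element of $\Psi$, i.e. there is $\psi\in\Psi$ with $d_\Psi(z_1,z_2)=m(\psi(z_1),\psi(z_2))$.
   Context: $\mathbb{D}$ is the open unit disc in $\mathbb{C}$. A domain $\Omega\subset\mathbb{C}^m$ is Carathéodory hyperbolic if the bounded holomorphic functions on $\Omega$ separate the points of $\Omega$. The Schur class $\mathscr{S}(\Omega)$ is the closed unit ball, for the supremum norm, of the Banach algebra of bounded holomorphic functions $\Omega\to\mathbb{C}$. A collection $\Psi$ of $\mathbb{C}$-valued functions on $\Omega$ is a set of test functions if (i) $\sup\{|\psi(z)|:\psi\in\Psi\}<1$ for each $z\in\Omega$; and (ii) for each finite subset $F\subset\Omega$, the restrictions $\{\psi|_F:\psi\in\Psi\}$ together with the constant function generate the algebra of all $\mathbb{C}$-valued functions on $F$. For a function $G:\Omega\times\Omega\to\mathbb{C}$, the notation $(G(z,w))_{z,w\in\Omega}\ge\mathbf{0}$ means $G$ is positive semidefinite: for each finite list $z_1,\dots,z_n\in\Omega$ the matrix $(G(z_i,z_j))_{i,j}$ is positive semidefinite.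 The set $\mathcal{K}_\Psi$ of $\Psi$-admissible kernels consists of all positive semidefinite functions $k:\Omega\times\Omega\to\mathbb{C}$ such that $\big((1-\psi(z)\overline{\psi(w)})k(z,w)\big)_{z,w\in\Omega}\ge\mathbf{0}$ for all $\psi\in\Psi$. The $\Psi$-Schur-Agler class $\mathscr{SA}_\Psi$ is the set of all functions $f:\Omega\to\mathbb{C}$ such that $\big((1-f(z)\overline{f(w)})k(z,w)\big)_{z,w\in\Omega}\ge\mathbf{0}$ for all $k\in\mathcal{K}_\Psi$. For $a,b\in\mathbb{D}$ put $m(a,b)=\left|\frac{a-b}{1-a\overline{b}}\right|$. For $z_1,z_2\in\Omega$ define $$d_\Psi(z_1,z_2)=\sup\{m(f(z_1),f(z_2)): f\in\mathscr{SA}_\Psi,\ f(\Omega)\subset\mathbb{D}\}.$$ "Closed under pointwise convergence" means closed in the topology of pointwise convergence on $\Omega$. *)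

theory Defs
  imports "HOL-Analysis.Analysis"
begin

text \<open>
  Functions on a set \<open>\<Omega>\<close> with complex values are elements of \<open>\<Omega> \<rightarrow>\<^sub>E UNIV\<close>, so that
  equality of functions is equality on \<open>\<Omega>\<close> and the topology of pointwise convergence on \<open>\<Omega>\<close>
  is \<open>product_topology (\<lambda>_. euclidean) \<Omega>\<close>.
\<close>

definition complex_domain :: "(complex^'m) set \<Rightarrow> bool" where
  "complex_domain \<Omega> \<longleftrightarrow> open \<Omega> \<and> connected \<Omega> \<and> \<Omega> \<noteq> {}"

text \<open>Holomorphy in several variables: the Frechet derivative is complex linear. It is
  intended for open \<open>\<Omega>\<close>, where values of \<open>f\<close> outside \<open>\<Omega>\<close> do not matter.\<close>

definition holomorphic_sev :: "(complex^'m \<Rightarrow> complex) \<Rightarrow> (complex^'m) set \<Rightarrow> bool" where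
  "holomorphic_sev f \<Omega> \<longleftrightarrow>
     (\<forall>z\<in>\<Omega>. \<exists>D. (f has_derivative D) (at z) \<and> (\<forall>c v. D (c *s v) = c * D v))"

definition bounded_holomorphic :: "(complex^'m) set \<Rightarrow> (complex^'m \<Rightarrow> complex) set" where
  "bounded_holomorphic \<Omega> = {f \<in> \<Omega> \<rightarrow>\<^sub>E UNIV. holomorphic_sev f \<Omega> \<and> bounded (f ` \<Omega>)}"

definition caratheodory_hyperbolic :: "(complex^'m) set \<Rightarrow> bool" where
  "caratheodory_hyperbolic \<Omega> \<longleftrightarrow>
     (\<forall>z\<in>\<Omega>. \<forall>w\<in>\<Omega>. z \<noteq> w \<longrightarrow> (\<exists>f\<in>bounded_holomorphic \<Omega>. f z \<noteq> f w))"

definition schur_class :: "(complex^'m) set \<Rightarrow> (complex^'m \<Rightarrow> complex) set" where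
  "schur_class \<Omega> = {f \<in> bounded_holomorphic \<Omega>. (SUP z\<in>\<Omega>. cmod (f z)) \<le> 1}"

text \<open>The unital subalgebra generated by \<open>S\<close> in the algebra \<open>F \<rightarrow>\<^sub>E UNIV\<close>.\<close>

inductive_set generated_algebra :: "'a set \<Rightarrow> ('a \<Rightarrow> complex) set \<Rightarrow> ('a \<Rightarrow> complex) set"
  for F :: "'a set" and S :: "('a \<Rightarrow> complex) set" where
  one: "(\<lambda>x\<in>F. 1) \<in> generated_algebra F S"
| gen: "f \<in> S \<Longrightarrow> f \<in> generated_algebra F S"
| scale: "f \<in> generated_algebra F S \<Longrightarrow> (\<lambda>x\<in>F. c * f x) \<in> generated_algebra F S"
| add: "f \<in> generated_algebra F S \<Longrightarrow> g \<in> generated_algebra F S \<Longrightarrow>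
    (\<lambda>x\<in>F. f x + g x) \<in> generated_algebra F S"
| mult: "f \<in> generated_algebra F S \<Longrightarrow> g \<in> generated_algebra F S \<Longrightarrow>
    (\<lambda>x\<in>F. f x * g x) \<in> generated_algebra F S"

text \<open>The supremum is taken in the extended reals, so it is meaningful without a prior bound on
  \<open>\<Psi>\<close>.\<close>

definition test_functions :: "'a set \<Rightarrow> ('a \<Rightarrow> complex) set \<Rightarrow> bool" where
  "test_functions \<Omega> \<Psi> \<longleftrightarrow>
     \<Psi> \<subseteq> \<Omega> \<rightarrow>\<^sub>E UNIV \<and>
     (\<forall>z\<in>\<Omega>. (SUP \<psi>\<in>\<Psi>. ereal (cmod (\<psi> z))) < 1) \<and>
     (\<forall>F. finite F \<and> F \<subseteq> \<Omega> \<longrightarrow>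
        generated_algebra F ((\<lambda>\<psi>. restrict \<psi> F) ` \<Psi>) = F \<rightarrow>\<^sub>E UNIV)"

text \<open>Membership of the quadratic form in the nonnegative reals includes that it is real, which
  forces the matrices to be Hermitian. Repeated points in the list are allowed.\<close>

definition psd_on :: "'a set \<Rightarrow> ('a \<Rightarrow> 'a \<Rightarrow> complex) \<Rightarrow> bool" where
  "psd_on \<Omega> G \<longleftrightarrow>
     (\<forall>zs (v :: nat \<Rightarrow> complex). set zs \<subseteq> \<Omega> \<longrightarrow>
        (\<Sum>i<length zs. \<Sum>j<length zs. cnj (v i) * G (zs ! i) (zs ! j) * v j) \<in> \<real>\<^sub>\<ge>\<^sub>0)"

definition admissible_kernels ::
    "'a set \<Rightarrow> ('a \<Rightarrow> complex) set \<Rightarrow> ('a \<Rightarrow> 'a \<Rightarrow> complex) set" where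
  "admissible_kernels \<Omega> \<Psi> =
     {k. psd_on \<Omega> k \<and> (\<forall>\<psi>\<in>\<Psi>. psd_on \<Omega> (\<lambda>z w. (1 - \<psi> z * cnj (\<psi> w)) * k z w))}"

definition schur_agler :: "'a set \<Rightarrow> ('a \<Rightarrow> complex) set \<Rightarrow> ('a \<Rightarrow> complex) set" where
  "schur_agler \<Omega> \<Psi> =
     {f \<in> \<Omega> \<rightarrow>\<^sub>E UNIV.
        \<forall>k\<in>admissible_kernels \<Omega> \<Psi>. psd_on \<Omega> (\<lambda>z w. (1 - f z * cnj (f w)) * k z w)}"

definition mob :: "complex \<Rightarrow> complex \<Rightarrow> real" where
  "mob a b = cmod ((a - b) / (1 - a * cnj b))"

definition dist_test :: "'a set \<Rightarrow> ('a \<Rightarrow> complex) set \<Rightarrow> 'a \<Rightarrow> 'a \<Rightarrow> real" where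
  "dist_test \<Omega> \<Psi> z1 z2 =
     Sup {mob (f z1) (f z2) | f. f \<in> schur_agler \<Omega> \<Psi> \<and> f ` \<Omega> \<subseteq> ball 0 1}"

end

theory Submission
  imports Defs
begin

text \<open>
  The identity is a statement about two points at a time, and it comes from a single kernel.
  Fix distinct points \<open>z1\<close>, \<open>z2\<close> and a number \<open>c\<close> in the unit interval, and let \<open>k\<close> be the kernel
  that has the matrix with diagonal \<open>1\<close> and off-diagonal \<open>c\<close> on \<open>{z1, z2}\<close> and vanishes elsewhere.
  For a function \<open>f\<close> with values in the disc, \<open>(1 - f z * cnj (f w)) * k z w\<close> is positive
  semidefinite iff its \<open>2 \<times> 2\<close> determinant is nonnegative, and by the identity
  \<open>1 - (mob a b)\<^sup>2 = (1 - \<bar>a\<bar>\<^sup>2) (1 - \<bar>b\<bar>\<^sup>2) / \<bar>1 - a * cnj b\<bar>\<^sup>2\<close> this says precisely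
  \<open>(mob (f z1) (f z2))\<^sup>2 \<le> 1 - c\<^sup>2\<close> (lemma \<open>psd_two_point_kernel_iff\<close>).

  Let \<open>r\<close> be the supremum of \<open>mob (\<psi> z1) (\<psi> z2)\<close> over the test functions, and take
  \<open>c = sqrt (1 - r\<^sup>2)\<close>. The kernel is then admissible, so every disc-valued function in the
  Schur-Agler class satisfies the same inequality, i.e. moves the two points at most \<open>r\<close> apart
  (lemma \<open>schur_agler_mob_le\<close>). Conversely the test functions are themselves disc-valued members
  of the Schur-Agler class, so the two suprema agree.

  If \<open>\<Psi>\<close> is closed for pointwise convergence, it is compact by Tychonoff's theorem, being a closed
  subset of a product of closed discs. The pairs \<open>(\<psi> z1, \<psi> z2)\<close> then form a compact subset of the
  open bidisc, on which \<open>mob\<close> is continuous, and the supremum is attained.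
\<close>

section \<open>The pseudohyperbolic distance\<close>

lemma norm_mult_cnj_less_1:
  assumes "cmod a < 1" and "cmod b < 1"
  shows "cmod (a * cnj b) < 1"
  using mult_strict_mono'[OF assms] by (simp add: norm_mult)

lemma one_minus_mult_cnj_neq_0:
  assumes "cmod a < 1" and "cmod b < 1"
  shows "1 - a * cnj b \<noteq> 0"
  using norm_mult_cnj_less_1[OF assms] by auto

lemma norm_one_minus_mult_cnj_squared:
  "(cmod (1 - a * cnj b))\<^sup>2 - (cmod (a - b))\<^sup>2 = (1 - (cmod a)\<^sup>2) * (1 - (cmod b)\<^sup>2)"
  unfolding cmod_power2 by (simp add: algebra_simps power2_eq_square)

lemma one_minus_mob_squared:
  assumes "cmod a < 1" and "cmod b < 1"
  shows "1 - (mob a b)\<^sup>2 = (1 - (cmod a)\<^sup>2) * (1 - (cmod b)\<^sup>2) / (cmod (1 - a * cnj b))\<^sup>2"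
  unfolding norm_one_minus_mult_cnj_squared[symmetric] mob_def
  using one_minus_mult_cnj_neq_0[OF assms]
  by (simp add: norm_divide power_divide field_simps)

lemma mob_less_1:
  assumes "cmod a < 1" and "cmod b < 1"
  shows "mob a b < 1"
proof -
  have "0 < 1 - (mob a b)\<^sup>2"
    unfolding one_minus_mob_squared[OF assms]
    using assms one_minus_mult_cnj_neq_0[OF assms]
    by (intro divide_pos_pos mult_pos_pos) (simp_all add: abs_square_less_1)
  moreover have "0 \<le> mob a b"
    by (simp add: mob_def)
  ultimately show ?thesis
    by (simp add: abs_square_less_1)
qed

lemma mob_refl [simp]: "mob a a = 0"
  by (simp add: mob_def)

lemma mob_nonneg [simp]: "0 \<le> mob a b"
  by (simp add: mob_def)

lemma continuous_on_mob: "continuous_on (ball 0 1 \<times> ball 0 1) (\<lambda>(a, b). mob a b)"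
  unfolding mob_def case_prod_beta
proof (intro continuous_intros ballI)
  show "1 - fst p * cnj (snd p) \<noteq> 0" if "p \<in> ball 0 1 \<times> ball 0 1" for p :: "complex \<times> complex"
    using that by (intro one_minus_mult_cnj_neq_0) auto
qed

section \<open>Kernels supported on two points\<close>

definition two_point_kernel :: "'a \<Rightarrow> 'a \<Rightarrow> real \<Rightarrow> 'a \<Rightarrow> 'a \<Rightarrow> complex" where
  "two_point_kernel z1 z2 c z w =
     (if z = w then of_bool (z \<in> {z1, z2}) else if {z, w} = {z1, z2} then of_real c else 0)"

lemma hermitian_form_2_nonneg:
  fixes g x y :: complex and a b :: real
  assumes "0 \<le> a" and "0 \<le> b" and "(cmod g)\<^sup>2 \<le> a * b"
  shows "cnj x * a * x + cnj y * b * y + cnj x * g * y + cnj y * cnj g * x \<in> \<real>\<^sub>\<ge>\<^sub>0"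
    (is "?Q \<in> _")
proof -
  have Q: "?Q = of_real (a * (cmod x)\<^sup>2 + b * (cmod y)\<^sup>2 + 2 * Re (cnj x * g * y))"
    by (simp only: complex_eq_iff cmod_power2) (simp add: algebra_simps power2_eq_square)
  have "cmod g \<le> sqrt a * sqrt b"
    using assms by (simp add: real_le_rsqrt flip: real_sqrt_mult)
  then have "cmod (cnj x * g * y) \<le> cmod x * (sqrt a * sqrt b) * cmod y"
    by (simp add: norm_mult mult_left_mono mult_right_mono)
  then have "- (cmod x * (sqrt a * sqrt b) * cmod y) \<le> Re (cnj x * g * y)"
    using abs_Re_le_cmod[of "cnj x * g * y"] by linarith
  moreover have "0 \<le> (sqrt a * cmod x - sqrt b * cmod y)\<^sup>2"
    by simp
  moreover have "(sqrt a * cmod x - sqrt b * cmod y)\<^sup>2 =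
      a * (cmod x)\<^sup>2 + b * (cmod y)\<^sup>2 - 2 * (cmod x * (sqrt a * sqrt b) * cmod y)"
    using assms by (simp add: power2_diff power_mult_distrib)
  ultimately show ?thesis
    unfolding Q nonneg_Reals_of_real_iff by linarith
qed

text \<open>
  Repetitions in the list of points do no harm: the form of a kernel supported on \<open>{z1, z2}\<close>
  depends only on the total weights that the coefficients put on \<open>z1\<close> and on \<open>z2\<close>.
\<close>

lemma psd_on_two_pointI:
  fixes G :: "'a \<Rightarrow> 'a \<Rightarrow> complex" and a b :: real
  assumes "z1 \<noteq> z2"
    and diag: "G z1 z1 = of_real a" "G z2 z2 = of_real b"
    and herm: "G z2 z1 = cnj (G z1 z2)"
    and supp: "\<And>z w. z \<notin> {z1, z2} \<or> w \<notin> {z1, z2} \<Longrightarrow> G z w = 0"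
    and "0 \<le> a" "0 \<le> b" "(cmod (G z1 z2))\<^sup>2 \<le> a * b"
  shows "psd_on \<Omega> G"
  unfolding psd_on_def
proof (intro allI impI)
  fix zs :: "'a list" and v :: "nat \<Rightarrow> complex"
  let ?e = "\<lambda>p q. of_bool (q = p) :: complex"
  let ?S = "\<lambda>h. \<Sum>i<length zs. \<Sum>j<length zs. h i j :: complex"
  define V where "V p = (\<Sum>i<length zs. ?e p (zs ! i) * v i)" for p
  have form: "?S (\<lambda>i j. (cnj (v i) * ?e p (zs ! i)) * (t * (?e q (zs ! j) * v j))) = cnj (V p) * t * V q"
    for p q t
  proof -
    have "cnj (V p) = (\<Sum>i<length zs. cnj (v i) * ?e p (zs ! i))"
      unfolding V_def cnj_sum by (intro sum.cong) (simp_all add: mult.commute)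
    moreover have "t * V q = (\<Sum>j<length zs. t * (?e q (zs ! j) * v j))"
      unfolding V_def by (rule sum_distrib_left)
    ultimately have "cnj (V p) * (t * V q) =
        ?S (\<lambda>i j. (cnj (v i) * ?e p (zs ! i)) * (t * (?e q (zs ! j) * v j)))"
      by (simp only: sum_product)
    then show ?thesis
      by (simp only: mult.assoc)
  qed
  have G: "G z w = ?e z1 z * (a * ?e z1 w) + ?e z2 z * (b * ?e z2 w)
      + ?e z1 z * (G z1 z2 * ?e z2 w) + ?e z2 z * (cnj (G z1 z2) * ?e z1 w)" for z w
    using \<open>z1 \<noteq> z2\<close> supp[of z w] by (auto simp: diag herm)
  have "?S (\<lambda>i j. cnj (v i) * G (zs ! i) (zs ! j) * v j) =
      ?S (\<lambda>i j. (cnj (v i) * ?e z1 (zs ! i)) * (a * (?e z1 (zs ! j) * v j)))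
      + ?S (\<lambda>i j. (cnj (v i) * ?e z2 (zs ! i)) * (b * (?e z2 (zs ! j) * v j)))
      + ?S (\<lambda>i j. (cnj (v i) * ?e z1 (zs ! i)) * (G z1 z2 * (?e z2 (zs ! j) * v j)))
      + ?S (\<lambda>i j. (cnj (v i) * ?e z2 (zs ! i)) * (cnj (G z1 z2) * (?e z1 (zs ! j) * v j)))"
    unfolding sum.distrib[symmetric]
    by (intro sum.cong refl, subst G) (simp only: distrib_left distrib_right mult.assoc)
  also have "\<dots> \<in> \<real>\<^sub>\<ge>\<^sub>0"
    unfolding form using assms by (intro hermitian_form_2_nonneg)
  finally show "?S (\<lambda>i j. cnj (v i) * G (zs ! i) (zs ! j) * v j) \<in> \<real>\<^sub>\<ge>\<^sub>0" .
qed

lemma psd_on_two_pointD: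
  fixes G :: "'a \<Rightarrow> 'a \<Rightarrow> complex" and a b :: real
  assumes "psd_on \<Omega> G" and "z1 \<in> \<Omega>" "z2 \<in> \<Omega>"
    and diag: "G z1 z1 = of_real a" "G z2 z2 = of_real b"
    and herm: "G z2 z1 = cnj (G z1 z2)"
    and "0 < a"
  shows "(cmod (G z1 z2))\<^sup>2 \<le> a * b"
proof -
  \<comment> \<open>The form at this vector is \<open>a\<close> times the determinant.\<close>
  define v where "v i = (if i = 0 then - G z1 z2 else of_real a)" for i :: nat
  let ?zs = "[z1, z2]"
  have "(\<Sum>i<length ?zs. \<Sum>j<length ?zs. cnj (v i) * G (?zs ! i) (?zs ! j) * v j)
      = of_real (a * (a * b - (cmod (G z1 z2))\<^sup>2))"
    by (simp add: v_def diag herm lessThan_Suc numeral_2_eq_2 algebra_simps power2_eq_square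
        complex_eq_iff cmod_power2[unfolded power2_eq_square])
  moreover have "(\<Sum>i<length ?zs. \<Sum>j<length ?zs. cnj (v i) * G (?zs ! i) (?zs ! j) * v j) \<in> \<real>\<^sub>\<ge>\<^sub>0"
    using assms(1)[unfolded psd_on_def, rule_format, of ?zs v] assms(2,3) by (simp only: list.set) blast
  ultimately have "0 \<le> a * (a * b - (cmod (G z1 z2))\<^sup>2)"
    by (simp only: nonneg_Reals_of_real_iff)
  then show ?thesis
    using \<open>0 < a\<close> by (simp add: zero_le_mult_iff)
qed

text \<open>
  The Pick matrix of \<open>f\<close> at two points, weighted by the kernel, has the diagonal entries
  \<open>1 - \<bar>f z1\<bar>\<^sup>2\<close> and \<open>1 - \<bar>f z2\<bar>\<^sup>2\<close>; the pseudohyperbolic distance measures the size of its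
  off-diagonal entry against them.
\<close>

lemma psd_two_point_kernel_iff:
  assumes "z1 \<noteq> z2" "z1 \<in> \<Omega>" "z2 \<in> \<Omega>"
    and f: "cmod (f z1) < 1" "cmod (f z2) < 1"
  shows "psd_on \<Omega> (\<lambda>z w. (1 - f z * cnj (f w)) * two_point_kernel z1 z2 c z w) \<longleftrightarrow>
     (mob (f z1) (f z2))\<^sup>2 \<le> 1 - c\<^sup>2"
proof -
  let ?G = "\<lambda>z w. (1 - f z * cnj (f w)) * two_point_kernel z1 z2 c z w"
  let ?a = "1 - (cmod (f z1))\<^sup>2" and ?b = "1 - (cmod (f z2))\<^sup>2"
  have pos: "0 < ?a" "0 < ?b"
    using f by (simp_all add: abs_square_less_1)
  have diag: "?G z1 z1 = of_real ?a" "?G z2 z2 = of_real ?b"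
    by (simp_all add: two_point_kernel_def complex_norm_square del: of_real_power)
  have herm: "?G z2 z1 = cnj (?G z1 z2)"
    using \<open>z1 \<noteq> z2\<close> by (auto simp: two_point_kernel_def)
  have supp: "?G z w = 0" if "z \<notin> {z1, z2} \<or> w \<notin> {z1, z2}" for z w
    using that by (auto simp: two_point_kernel_def)
  have "psd_on \<Omega> ?G \<longleftrightarrow> (cmod (?G z1 z2))\<^sup>2 \<le> ?a * ?b"
  proof
    show "(cmod (?G z1 z2))\<^sup>2 \<le> ?a * ?b" if "psd_on \<Omega> ?G"
      using that \<open>z1 \<in> \<Omega>\<close> \<open>z2 \<in> \<Omega>\<close> diag herm pos(1) by (rule psd_on_two_pointD)
    show "psd_on \<Omega> ?G" if "(cmod (?G z1 z2))\<^sup>2 \<le> ?a * ?b"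
      using \<open>z1 \<noteq> z2\<close> diag herm supp less_imp_le[OF pos(1)] less_imp_le[OF pos(2)] that
      by (rule psd_on_two_pointI)
  qed
  also have "\<dots> \<longleftrightarrow> (cmod (1 - f z1 * cnj (f z2)))\<^sup>2 * c\<^sup>2 \<le> ?a * ?b"
    using \<open>z1 \<noteq> z2\<close> by (simp add: two_point_kernel_def norm_mult power_mult_distrib)
  also have "\<dots> \<longleftrightarrow> c\<^sup>2 \<le> 1 - (mob (f z1) (f z2))\<^sup>2"
    using one_minus_mult_cnj_neq_0[OF f]
    by (simp add: one_minus_mob_squared[OF f] pos_le_divide_eq mult.commute)
  also have "\<dots> \<longleftrightarrow> (mob (f z1) (f z2))\<^sup>2 \<le> 1 - c\<^sup>2"
    by linarith
  finally show ?thesis .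
qed

lemma psd_on_two_point_kernel:
  assumes "z1 \<noteq> z2" and "c\<^sup>2 \<le> 1"
  shows "psd_on \<Omega> (two_point_kernel z1 z2 c)"
  using assms
  by (intro psd_on_two_pointI[of z1 z2 _ 1 1]) (simp_all add: two_point_kernel_def doubleton_eq_iff, blast)

section \<open>Distances under the Schur-Agler class\<close>

text \<open>
  The two-point kernel with off-diagonal entry \<open>sqrt (1 - r\<^sup>2)\<close> is the extremal one: it is
  admissible because \<open>r\<close> bounds the distances given by \<open>\<Psi>\<close>, and testing \<open>f\<close> against it returns the
  same bound.
\<close>

lemma schur_agler_mob_le:
  assumes pts: "z1 \<in> \<Omega>" "z2 \<in> \<Omega>"
    and disc: "\<And>\<psi> z. \<psi> \<in> \<Psi> \<Longrightarrow> z \<in> \<Omega> \<Longrightarrow> cmod (\<psi> z) < 1"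
    and r: "0 \<le> r" "r \<le> 1" "\<And>\<psi>. \<psi> \<in> \<Psi> \<Longrightarrow> mob (\<psi> z1) (\<psi> z2) \<le> r"
    and f: "f \<in> schur_agler \<Omega> \<Psi>" "f ` \<Omega> \<subseteq> ball 0 1"
  shows "mob (f z1) (f z2) \<le> r"
proof (cases "z1 = z2")
  case False
  define c where "c = sqrt (1 - r\<^sup>2)"
  have c: "1 - c\<^sup>2 = r\<^sup>2"
    using r by (simp add: c_def power_le_one)
  have "two_point_kernel z1 z2 c \<in> admissible_kernels \<Omega> \<Psi>"
    unfolding admissible_kernels_def
  proof (intro CollectI conjI ballI)
    have "c\<^sup>2 \<le> 1"
      using c zero_le_power2[of r] by linarith
    with False show "psd_on \<Omega> (two_point_kernel z1 z2 c)"
      by (rule psd_on_two_point_kernel)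
    show "psd_on \<Omega> (\<lambda>z w. (1 - \<psi> z * cnj (\<psi> w)) * two_point_kernel z1 z2 c z w)" if "\<psi> \<in> \<Psi>" for \<psi>
      using that r(3) by (simp add: psd_two_point_kernel_iff[OF False pts] disc pts c power_mono)
  qed
  then have "psd_on \<Omega> (\<lambda>z w. (1 - f z * cnj (f w)) * two_point_kernel z1 z2 c z w)"
    using f(1) by (simp add: schur_agler_def)
  then have "(mob (f z1) (f z2))\<^sup>2 \<le> r\<^sup>2"
    using f(2) pts by (subst (asm) psd_two_point_kernel_iff[OF False pts]) (auto simp: c)
  then show ?thesis
    using \<open>0 \<le> r\<close> by (rule power2_le_imp_le)
qed (simp add: \<open>0 \<le> r\<close>)

lemma test_functions_norm_less_1:
  assumes "test_functions \<Omega> \<Psi>" and "\<psi> \<in> \<Psi>" and "z \<in> \<Omega>"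
  shows "cmod (\<psi> z) < 1"
proof -
  have "ereal (cmod (\<psi> z)) \<le> (SUP \<psi>\<in>\<Psi>. ereal (cmod (\<psi> z)))"
    using assms(2) by (rule SUP_upper)
  also have "\<dots> < 1"
    using assms by (simp add: test_functions_def)
  finally show ?thesis
    by simp
qed

lemma test_functions_subset_schur_agler:
  assumes "test_functions \<Omega> \<Psi>"
  shows "\<Psi> \<subseteq> schur_agler \<Omega> \<Psi>"
proof
  fix \<psi>
  assume "\<psi> \<in> \<Psi>"
  moreover from this have "\<psi> \<in> \<Omega> \<rightarrow>\<^sub>E UNIV"
    using assms unfolding test_functions_def by (elim conjE subsetD)
  ultimately show "\<psi> \<in> schur_agler \<Omega> \<Psi>"
    by (simp add: schur_agler_def admissible_kernels_def)
qed

lemma generated_algebra_empty_constant: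
  assumes "f \<in> generated_algebra F {}" and "x \<in> F" and "y \<in> F"
  shows "f x = f y"
  using assms by (induction rule: generated_algebra.induct) auto

text \<open>
  Without test functions only constants would be generated, and these do not separate points.
  Nonemptiness matters because the supremum of an empty set of reals is an arbitrary number.
\<close>

lemma test_functions_nonempty:
  assumes "test_functions \<Omega> \<Psi>" and "x \<in> \<Omega>" "y \<in> \<Omega>" "x \<noteq> y"
  shows "\<Psi> \<noteq> {}"
proof
  assume "\<Psi> = {}"
  let ?g = "\<lambda>z\<in>{x, y}. of_bool (z = x) :: complex"
  have "generated_algebra {x, y} {} = {x, y} \<rightarrow>\<^sub>E UNIV"
    using assms \<open>\<Psi> = {}\<close> unfolding test_functions_def
    by (metis empty_subsetI finite.emptyI finite.insertI image_empty insert_subset)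
  then have "?g \<in> generated_algebra {x, y} {}"
    by auto
  from generated_algebra_empty_constant[OF this, of x y] \<open>x \<noteq> y\<close> show False
    by simp
qed

lemma dist_test_eq_SUP:
  assumes \<Psi>: "test_functions \<Omega> \<Psi>" "\<Psi> \<noteq> {}"
    and pts: "z1 \<in> \<Omega>" "z2 \<in> \<Omega>"
  shows "dist_test \<Omega> \<Psi> z1 z2 = (SUP \<psi>\<in>\<Psi>. mob (\<psi> z1) (\<psi> z2))"
proof -
  note disc = test_functions_norm_less_1[OF \<Psi>(1)]
  define r where "r = (SUP \<psi>\<in>\<Psi>. mob (\<psi> z1) (\<psi> z2))"
  have le_1: "mob (\<psi> z1) (\<psi> z2) \<le> 1" if "\<psi> \<in> \<Psi>" for \<psi>
    using that disc pts by (intro less_imp_le mob_less_1) auto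
  have upper: "mob (\<psi> z1) (\<psi> z2) \<le> r" if "\<psi> \<in> \<Psi>" for \<psi>
    unfolding r_def using that le_1 by (intro cSUP_upper bdd_aboveI2) auto
  have "0 \<le> r"
    using \<Psi>(2) upper mob_nonneg by (metis all_not_in_conv order_trans)
  have "r \<le> 1"
    unfolding r_def using \<Psi>(2) le_1 by (rule cSUP_least)
  let ?D = "{mob (f z1) (f z2) | f. f \<in> schur_agler \<Omega> \<Psi> \<and> f ` \<Omega> \<subseteq> ball 0 1}"
  have D: "(\<lambda>\<psi>. mob (\<psi> z1) (\<psi> z2)) ` \<Psi> \<subseteq> ?D"
    using test_functions_subset_schur_agler[OF \<Psi>(1)] disc by fastforce
  have D_le: "d \<le> r" if d: "d \<in> ?D" for d
  proof -
    obtain f where f: "d = mob (f z1) (f z2)" "f \<in> schur_agler \<Omega> \<Psi>" "f ` \<Omega> \<subseteq> ball 0 1"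
      using d by blast
    show ?thesis
      unfolding f(1) using pts disc \<open>0 \<le> r\<close> \<open>r \<le> 1\<close> upper f(2,3) by (rule schur_agler_mob_le)
  qed
  have "Sup ?D \<le> r"
    using D \<Psi>(2) by (intro cSup_least D_le) blast+
  moreover have "r \<le> Sup ?D"
    unfolding r_def using D \<Psi>(2) D_le by (intro cSup_subset_mono bdd_aboveI[of _ r]) auto
  ultimately show ?thesis
    by (simp add: dist_test_def r_def)
qed

section \<open>Compactness and attainment\<close>

lemma compact_evaluation_at_two_points:
  fixes \<Psi> :: "('a \<Rightarrow> complex) set"
  assumes closed: "closedin (product_topology (\<lambda>_. euclidean) \<Omega>) \<Psi>"
    and disc: "\<And>\<psi> z. \<psi> \<in> \<Psi> \<Longrightarrow> z \<in> \<Omega> \<Longrightarrow> cmod (\<psi> z) \<le> 1"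
    and pts: "z1 \<in> \<Omega>" "z2 \<in> \<Omega>"
  shows "compact ((\<lambda>\<psi>. (\<psi> z1, \<psi> z2)) ` \<Psi>)"
proof -
  let ?T = "product_topology (\<lambda>_. euclidean :: complex topology) \<Omega>"
  have "\<Psi> \<subseteq> \<Omega> \<rightarrow>\<^sub>E UNIV"
    using closedin_subset[OF closed] by simp
  then have "\<Psi> \<subseteq> \<Omega> \<rightarrow>\<^sub>E cball 0 1"
    using disc by (simp add: subset_iff PiE_iff)
  moreover have "compactin ?T (\<Omega> \<rightarrow>\<^sub>E cball 0 1)"
    by (simp add: compactin_PiE)
  ultimately have "compactin ?T \<Psi>"
    using closed closed_compactin by blast
  moreover have "continuous_map ?T (prod_topology euclidean euclidean) (\<lambda>\<psi>. (\<psi> z1, \<psi> z2))"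
    using pts by (intro continuous_map_pairedI continuous_map_product_projection)
  ultimately have "compactin (prod_topology euclidean euclidean) ((\<lambda>\<psi>. (\<psi> z1, \<psi> z2)) ` \<Psi>)"
    by (rule image_compactin)
  then show ?thesis
    by (simp only: prod_topology_euclidean compactin_euclidean_iff)
qed

theorem corollary2p2:
  fixes \<Omega> :: "(complex^'m) set"
    and \<Psi> :: "(complex^'m \<Rightarrow> complex) set"
    and w0 :: "complex^'m"
  assumes "complex_domain \<Omega>"
    and "caratheodory_hyperbolic \<Omega>"
    and "\<Psi> \<subseteq> schur_class \<Omega>"
    and "test_functions \<Omega> \<Psi>"
    and "w0 \<in> \<Omega>"
    and "\<forall>\<psi>\<in>\<Psi>. \<psi> w0 = 0"
  shows "(\<forall>z1\<in>\<Omega>. \<forall>z2\<in>\<Omega>.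
            dist_test \<Omega> \<Psi> z1 z2 = (SUP \<psi>\<in>\<Psi>. mob (\<psi> z1) (\<psi> z2))) \<and>
         (closedin (product_topology (\<lambda>_. euclidean) \<Omega>) \<Psi> \<longrightarrow>
            (\<forall>z1\<in>\<Omega>. \<forall>z2\<in>\<Omega>. \<exists>\<psi>\<in>\<Psi>. dist_test \<Omega> \<Psi> z1 z2 = mob (\<psi> z1) (\<psi> z2)))"
proof (intro conjI impI ballI)
  note \<Psi> = \<open>test_functions \<Omega> \<Psi>\<close>
  have "open \<Omega>"
    using assms(1) by (simp add: complex_domain_def)
  then have "\<Omega> \<noteq> {w0}"
    using not_open_singleton[of w0] by metis
  then obtain w1 where "w1 \<in> \<Omega>" "w1 \<noteq> w0"
    using \<open>w0 \<in> \<Omega>\<close> by blast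
  then have ne: "\<Psi> \<noteq> {}"
    using test_functions_nonempty[OF \<Psi>] \<open>w0 \<in> \<Omega>\<close> by blast
  fix z1 z2
  assume pts: "z1 \<in> \<Omega>" "z2 \<in> \<Omega>"
  show eq: "dist_test \<Omega> \<Psi> z1 z2 = (SUP \<psi>\<in>\<Psi>. mob (\<psi> z1) (\<psi> z2))"
    using \<Psi> ne pts by (rule dist_test_eq_SUP)
  assume closed: "closedin (product_topology (\<lambda>_. euclidean) \<Omega>) \<Psi>"
  let ?K = "(\<lambda>\<psi>. (\<psi> z1, \<psi> z2)) ` \<Psi>"
  note disc = test_functions_norm_less_1[OF \<Psi>]
  have "compact ?K"
    using closed less_imp_le[OF disc] pts by (rule compact_evaluation_at_two_points)
  moreover have "continuous_on ?K (\<lambda>(a, b). mob a b)"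
    using disc pts by (intro continuous_on_subset[OF continuous_on_mob]) auto
  ultimately obtain \<psi> where "\<psi> \<in> \<Psi>"
    and max: "\<And>\<phi>. \<phi> \<in> \<Psi> \<Longrightarrow> mob (\<phi> z1) (\<phi> z2) \<le> mob (\<psi> z1) (\<psi> z2)"
    using continuous_attains_sup[of ?K "\<lambda>(a, b). mob a b"] ne by auto
  then have "(SUP \<psi>\<in>\<Psi>. mob (\<psi> z1) (\<psi> z2)) = mob (\<psi> z1) (\<psi> z2)"
    by (intro cSup_eq_maximum) auto
  with eq \<open>\<psi> \<in> \<Psi>\<close> show "\<exists>\<psi>\<in>\<Psi>. dist_test \<Omega> \<Psi> z1 z2 = mob (\<psi> z1) (\<psi> z2)"
    by auto
qed

end
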